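(* Let $A = (a_{ij})$ be an $n \times n$ complex matrix such that $$\sum_{j=1}^n |a_{ij}| < 1 \quad \text{for } i = 1, \ldots, n.$$ Then $\operatorname{per}(I + A) \neq 0$, where $I$ is the $n \times n$ identity matrix.
   Context: For an $n\times n$ complex matrix $B=(b_{ij})$, its permanent is $\operatorname{per} B = \sum_{\sigma \in S_n} \prod_{i=1}^n b_{i\sigma(i)}$, where $S_n$ is the symmetric group of all permutations of $\{1,\ldots,n\}$. *)

theory Defs
  imports "HOL-Analysis.Analysis"
begin

definition per :: "'a::comm_semiring_1^'n^'n \<Rightarrow> 'a" where
  "per B = (\<Sum>p\<in>{p. p permutes (UNIV :: 'n set)}. \<Prod>i\<in>UNIV. B $ i $ p i)"

end

theory Submission
  imports Defs
begin

text \<open>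
  Nonvanishing in dimension \<open>n\<close> yields a bound: if replacing column \<open>j\<close> of \<open>I + A\<close> by \<open>v\<close> gives a
  permanent \<open>H\<close>, where \<open>\<bar>v\<^sub>k\<bar> + (\<Sum>l. \<bar>a\<^sub>k\<^sub>l\<bar>) < 1\<close> for all \<open>k\<close>, then adding \<open>t v\<close> to that column keeps
  the row sums below 1 for \<open>\<bar>t\<bar> \<le> 1\<close>, so \<open>per (I + A) + t H \<noteq> 0\<close> and hence \<open>\<bar>H\<bar> \<le> \<bar>per (I + A)\<bar>\<close>.
  In dimension \<open>n + 1\<close>, expand along row \<open>i\<close>. The cofactor at \<open>(i, i)\<close> is the permanent \<open>f\<close> of the
  submatrix without row and column \<open>i\<close>; the one at \<open>(i, j)\<close> is the permanent of the same submatrix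
  with column \<open>j\<close> replaced by column \<open>i\<close>, so it is bounded by \<open>\<bar>f\<bar>\<close>. Hence
  \<open>\<bar>per (I + A)\<bar> \<ge> \<bar>f\<bar> (1 - (\<Sum>j. \<bar>a\<^sub>i\<^sub>j\<bar>)) > 0\<close>.
\<close>

text \<open>Indexing by a set instead of a type lets the induction drop a single index.\<close>

definition per_on :: "'i set \<Rightarrow> ('i \<Rightarrow> 'i \<Rightarrow> 'a::comm_semiring_1) \<Rightarrow> 'a" where
  "per_on S B = (\<Sum>p\<in>{p. p permutes S}. \<Prod>i\<in>S. B i (p i))"

definition replace_col :: "'i \<Rightarrow> ('i \<Rightarrow> 'a) \<Rightarrow> ('i \<Rightarrow> 'i \<Rightarrow> 'a) \<Rightarrow> 'i \<Rightarrow> 'i \<Rightarrow> 'a" where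
  "replace_col j v B = (\<lambda>k l. if l = j then v k else B k l)"

lemma per_on_cong:
  assumes "\<And>k l. k \<in> S \<Longrightarrow> l \<in> S \<Longrightarrow> B k l = C k l"
  shows "per_on S B = per_on S C"
  unfolding per_on_def
  by (intro sum.cong prod.cong refl assms) (auto simp: permutes_in_image)

text \<open>Laplace expansion along row \<open>i\<close>. Putting column \<open>i\<close> in the
  place of the deleted column \<open>j\<close> makes each minor a matrix indexed by
  \<open>S\<close>; permanents carry no signs, so this reordering is free.\<close>

lemma per_on_insert:
  assumes "finite S" "i \<notin> S"
  shows "per_on (insert i S) B =
    B i i * per_on S B + (\<Sum>j\<in>S. B i j * per_on S (replace_col j (\<lambda>k. B k i) B))"
proof -
  \<comment> \<open>Permutations of \<open>insert i S\<close> factor uniquely as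
    \<open>transpose i b\<close> after some \<open>q\<close> on \<open>S\<close>: row
    \<open>i\<close> takes column \<open>b\<close>, and the row that \<open>q\<close> sends to
    \<open>b\<close> takes column \<open>i\<close>.\<close>
  have expand: "(\<Prod>k\<in>insert i S. B k ((Transposition.transpose i b \<circ> q) k)) =
      B i b * (\<Prod>k\<in>S. replace_col b (\<lambda>k. B k i) B k (q k))"
    if q: "q permutes S" for b q
  proof -
    have qi: "q i = i" using q assms(2) by (simp add: permutes_not_in)
    have "B k (Transposition.transpose i b (q k)) = replace_col b (\<lambda>k. B k i) B k (q k)" if "k \<in> S" for k
    proof -
      have "q k \<noteq> i" using q that assms(2) by (metis permutes_in_image)
      then show ?thesis by (simp add: replace_col_def Transposition.transpose_def)
    qed
    then show ?thesis using assms by (simp add: qi)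
  qed
  have "per_on (insert i S) B = (\<Sum>b\<in>insert i S. \<Sum>q\<in>{q. q permutes S}.
      \<Prod>k\<in>insert i S. B k ((Transposition.transpose i b \<circ> q) k))"
    unfolding per_on_def by (rule sum_over_permutations_insert[OF assms])
  also have "\<dots> = (\<Sum>b\<in>insert i S. B i b * per_on S (replace_col b (\<lambda>k. B k i) B))"
    unfolding per_on_def sum_distrib_left by (intro sum.cong refl expand) simp
  also have "\<dots> = B i i * per_on S (replace_col i (\<lambda>k. B k i) B)
      + (\<Sum>j\<in>S. B i j * per_on S (replace_col j (\<lambda>k. B k i) B))"
    using assms by simp
  also have "per_on S (replace_col i (\<lambda>k. B k i) B) = per_on S B"
    by (rule per_on_cong) (simp add: replace_col_def)
  finally show ?thesis .
qed

text \<open>Each product contains exactly one entry of column \<open>j\<close>, so it is affine in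
  that column.\<close>

lemma per_on_replace_col_linear:
  assumes "finite S" "j \<in> S"
  shows "per_on S (replace_col j (\<lambda>k. B k j + t * v k) B) =
    per_on S B + t * per_on S (replace_col j v B)"
proof -
  have "(\<Prod>k\<in>S. replace_col j (\<lambda>k. B k j + t * v k) B k (q k)) =
      (\<Prod>k\<in>S. B k (q k)) + t * (\<Prod>k\<in>S. replace_col j v B k (q k))"
    if q: "q permutes S" for q
  proof -
    obtain m where m: "m \<in> S" "q m = j"
      using q assms(2) by (metis permutes_image imageE)
    have ne: "q k \<noteq> j" if "k \<in> S - {m}" for k
      using that m q by (metis DiffD2 insertI1 injD permutes_inj)
    have rest: "(\<Prod>k\<in>S - {m}. replace_col j w B k (q k)) = (\<Prod>k\<in>S - {m}. B k (q k))" for w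
      by (rule prod.cong) (use ne in \<open>auto simp: replace_col_def\<close>)
    show ?thesis
      unfolding prod.remove[OF assms(1) m(1)] rest
      by (simp add: replace_col_def m(2) algebra_simps)
  qed
  then show ?thesis
    unfolding per_on_def by (simp add: sum.distrib sum_distrib_left)
qed

lemma per_on_id_plus_nonzero:
  fixes A :: "'i \<Rightarrow> 'i \<Rightarrow> complex"
  assumes "finite S" and "\<And>i. i \<in> S \<Longrightarrow> (\<Sum>j\<in>S. cmod (A i j)) < 1"
  shows "per_on S (\<lambda>i j. of_bool (i = j) + A i j) \<noteq> 0"
  using assms
proof (induction S arbitrary: A rule: finite_induct)
  case empty
  then show ?case by (simp add: per_on_def)
next
  case (insert i S)
  define B where "B = (\<lambda>k l. of_bool (k = l) + A k l)"
  define f where "f = per_on S B"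
  define H where "H j = per_on S (replace_col j (\<lambda>k. B k i) B)" for j
  have row: "cmod (A k i) + (\<Sum>l\<in>S. cmod (A k l)) < 1" if "k \<in> insert i S" for k
    using insert.prems[OF that] insert.hyps by simp
  have "(\<Sum>l\<in>S. cmod (A k l)) < 1" if "k \<in> S" for k
    using row[of k] that norm_ge_zero[of "A k i"] by (simp del: norm_ge_zero)
  then have f0: "f \<noteq> 0"
    unfolding f_def B_def by (rule insert.IH)
  have H_le: "cmod (H j) \<le> cmod f" if j: "j \<in> S" for j
  proof (rule ccontr)
    assume "\<not> cmod (H j) \<le> cmod f"
    then have lt: "cmod f < cmod (H j)" by simp
    then have H0: "H j \<noteq> 0" by auto
    \<comment> \<open>The root of \<open>f + t * H j\<close>, which lies in the unit disc because
      \<open>H j\<close> exceeds \<open>f\<close> in modulus.\<close>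
    define t where "t = - f / H j"
    have t: "cmod t \<le> 1"
      using lt H0 by (simp add: t_def norm_divide divide_simps)
    define A' where "A' = replace_col j (\<lambda>k. A k j + t * B k i) A"
    \<comment> \<open>The entry \<open>A k i\<close>, outside the columns in \<open>S\<close>, pays
      for what is added to column \<open>j\<close>.\<close>
    have "(\<Sum>l\<in>S. cmod (A' k l)) < 1" if k: "k \<in> S" for k
    proof -
      have "k \<noteq> i" using k insert.hyps by auto
      then have "cmod (t * B k i) \<le> cmod (A k i)"
        using t by (simp add: B_def norm_mult mult_left_le_one_le)
      then have "cmod (A' k j) \<le> cmod (A k j) + cmod (A k i)"
        using norm_triangle_ineq[of "A k j" "t * B k i"] by (simp add: A'_def replace_col_def)
      moreover have "(\<Sum>l\<in>S - {j}. cmod (A' k l)) = (\<Sum>l\<in>S - {j}. cmod (A k l))"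
        by (rule sum.cong) (auto simp: A'_def replace_col_def)
      ultimately have "(\<Sum>l\<in>S. cmod (A' k l)) \<le> cmod (A k i) + (\<Sum>l\<in>S. cmod (A k l))"
        by (simp add: sum.remove[OF insert.hyps(1) j])
      then show ?thesis using row[of k] k by simp
    qed
    then have "per_on S (\<lambda>k l. of_bool (k = l) + A' k l) \<noteq> 0"
      by (rule insert.IH)
    moreover have "(\<lambda>k l. of_bool (k = l) + A' k l) = replace_col j (\<lambda>k. B k j + t * B k i) B"
      by (auto simp: fun_eq_iff A'_def B_def replace_col_def)
    moreover have "per_on S (replace_col j (\<lambda>k. B k j + t * B k i) B) = f + t * H j"
      unfolding f_def H_def by (rule per_on_replace_col_linear[OF insert.hyps(1) j])
    ultimately show False using H0 by (simp add: t_def)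
  qed
  have Bij: "B i j = A i j" if "j \<in> S" for j
    using that insert.hyps by (auto simp: B_def)
  have "per_on (insert i S) B = B i i * f + (\<Sum>j\<in>S. B i j * H j)"
    unfolding f_def H_def by (rule per_on_insert[OF insert.hyps(1,2)])
  \<comment> \<open>The identity contributes only the leading \<open>f\<close>; the rest is strictly
    smaller in modulus by the bound on row \<open>i\<close>.\<close>
  also have "\<dots> = f + (A i i * f + (\<Sum>j\<in>S. A i j * H j))"
    using Bij by (simp add: B_def algebra_simps)
  finally have expansion: "per_on (insert i S) B = f + (A i i * f + (\<Sum>j\<in>S. A i j * H j))" .
  have "cmod (A i i * f + (\<Sum>j\<in>S. A i j * H j))
      \<le> cmod (A i i) * cmod f + (\<Sum>j\<in>S. cmod (A i j) * cmod f)"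
    by (intro norm_triangle_le add_mono sum_norm_le)
      (auto simp: norm_mult intro!: mult_left_mono H_le)
  also have "\<dots> = (cmod (A i i) + (\<Sum>j\<in>S. cmod (A i j))) * cmod f"
    by (simp add: algebra_simps sum_distrib_left)
  also have "\<dots> < cmod f"
    using row[of i] f0 by simp
  finally have "f + (A i i * f + (\<Sum>j\<in>S. A i j * H j)) \<noteq> 0"
    by (metis add_eq_0_iff norm_minus_cancel order_less_irrefl)
  then show ?case
    using expansion by (simp add: B_def)
qed

theorem theorem1p2:
  fixes A :: "complex^'n^'n"
  assumes "\<And>i. (\<Sum>j\<in>UNIV. cmod (A $ i $ j)) < 1"
  shows "per (mat 1 + A) \<noteq> 0"
proof -
  have "per (mat 1 + A) = per_on UNIV (\<lambda>i j. of_bool (i = j) + A $ i $ j)"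
    by (simp add: per_def per_on_def mat_def of_bool_def)
  then show ?thesis
    using per_on_id_plus_nonzero[of UNIV "\<lambda>i j. A $ i $ j"] assms by simp
qed

end
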